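(* Let $\mathbb{T}$ be a time scale with $0\in\mathbb{T}$ and let $\alpha:\mathbb{T}\to\mathbb{C}$ be regressive and rd-continuous. If $\mathrm{Re}\,\alpha(t)=0$ for all $t\in\mathbb{T}$, then $|E_\alpha(t)|=1$ for all $t\in\mathbb{T}$. (That is, $\alpha\mapsto E_\alpha(t)$ maps the imaginary axis into the unit circle.)
   Context: A time scale $\mathbb{T}$ is a nonempty closed subset of $\mathbb{R}$. Forward jump: $\sigma(t)=\inf\{s\in\mathbb{T}:s>t\}$ (with $\inf\emptyset=\sup\mathbb{T}$). A point $t$ is right-dense if $\sigma(t)=t$, right-scattered if $\sigma(t)>t$; left-dense/left-scattered are defined analogously with the backward jump operator. $\mathbb{T}^\kappa$ is $\mathbb{T}$ minus its left-scattered maximum if that exists, and $\mathbb{T}^\kappa=\mathbb{T}$ otherwise. Graininess: $\mu(t)=\sigma(t)-t$. A function is rd-continuous if it is continuous at right-dense points and has finite left-hand limits at left-dense points. The delta derivative at $t\in\mathbb{T}^\kappa$ is $f^\Delta(t)=\lim_{s\to t,\,s\neq\sigma(t)}\frac{f(\sigma(t))-f(s)}{\sigma(t)-s}$ ($s\in\mathbb{T}$, $s=t$ allowed when $t\ne\sigma(t)$). The delta integral is $\int_{t_0}^t f(s)\,\Delta s=F(t)-F(t_0)$ where $F^\Delta=f$ on $\mathbb{T}^\kappa$; it exists for rd-continuous $f$. A function $\alpha:\mathbb{T}\to\mathbb{C}$ is regressive if $\mu(t)\alpha(t)\neq\pm2$ for all $t\in\mathbb{T}^\kappa$. With $\log$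 the principal branch of the complex logarithm, $\zeta_h(z)=\frac1h\log\frac{1+\frac12zh}{1-\frac12zh}$ for $h>0$ and $\zeta_0(z)=z$. For rd-continuous regressive $\alpha$, the Cayley-exponential function is $E_\alpha(t)=\exp\left(\int_{0}^t\zeta_{\mu(s)}(\alpha(s))\,\Delta s\right)$. *)

theory Defs
  imports "HOL-Analysis.Analysis"
begin

definition time_scale :: "real set \<Rightarrow> bool" where
  "time_scale T \<longleftrightarrow> T \<noteq> {} \<and> closed T"

(* The conventions inf {} = sup T and sup {} = inf T are spelled out in the else-branches, since
   Inf {} and Sup {} are unspecified reals. For t in T these branches are reached only if t is the
   maximum (minimum) of T, so that the value is t itself. *)
definition forward_jump :: "real set \<Rightarrow> real \<Rightarrow> real" where
  "forward_jump T t = (if \<exists>s\<in>T. s > t then Inf {s \<in> T. s > t} else Sup T)"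

definition backward_jump :: "real set \<Rightarrow> real \<Rightarrow> real" where
  "backward_jump T t = (if \<exists>s\<in>T. s < t then Sup {s \<in> T. s < t} else Inf T)"

definition graininess :: "real set \<Rightarrow> real \<Rightarrow> real" where
  "graininess T t = forward_jump T t - t"

definition right_dense :: "real set \<Rightarrow> real \<Rightarrow> bool" where
  "right_dense T t \<longleftrightarrow> forward_jump T t = t"

definition left_dense :: "real set \<Rightarrow> real \<Rightarrow> bool" where
  "left_dense T t \<longleftrightarrow> backward_jump T t = t"

definition left_scattered :: "real set \<Rightarrow> real \<Rightarrow> bool" where
  "left_scattered T t \<longleftrightarrow> backward_jump T t < t"

definition kappa :: "real set \<Rightarrow> real set" where
  "kappa T = {t \<in> T. \<not> ((\<forall>s\<in>T. s \<le> t) \<and> left_scattered T t)}"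

(* Functions on T are total functions on the reals of which only the values on T are used. The
   minimum of T counts as left-dense, but its left-hand limit is along the trivial filter. *)
definition rd_continuous :: "real set \<Rightarrow> (real \<Rightarrow> 'a::topological_space) \<Rightarrow> bool" where
  "rd_continuous T f \<longleftrightarrow>
     (\<forall>t\<in>T. right_dense T t \<longrightarrow> (f \<longlongrightarrow> f t) (at t within T)) \<and>
     (\<forall>t\<in>T. left_dense T t \<longrightarrow> (\<exists>l. (f \<longlongrightarrow> l) (at t within (T \<inter> {..<t}))))"

(* The limit is over s -> t in T - {sigma t}. The filter is not "at t within ...", because s = t is
   allowed when t is right-scattered. *)
definition has_delta_derivative ::
    "real set \<Rightarrow> (real \<Rightarrow> 'a::real_normed_vector) \<Rightarrow> 'a \<Rightarrow> real \<Rightarrow> bool" where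
  "has_delta_derivative T f D t \<longleftrightarrow>
     ((\<lambda>s. (f (forward_jump T t) - f s) /\<^sub>R (forward_jump T t - s)) \<longlongrightarrow> D)
       (inf (nhds t) (principal (T - {forward_jump T t})))"

definition delta_antiderivative ::
    "real set \<Rightarrow> (real \<Rightarrow> 'a::real_normed_vector) \<Rightarrow> (real \<Rightarrow> 'a) \<Rightarrow> bool" where
  "delta_antiderivative T f F \<longleftrightarrow> (\<forall>t\<in>kappa T. has_delta_derivative T F (f t) t)"

(* For a, b in T the value does not depend on the chosen F, as antiderivatives of the same
   function differ on T by a constant. *)
definition delta_integral ::
    "real set \<Rightarrow> real \<Rightarrow> real \<Rightarrow> (real \<Rightarrow> 'a::real_normed_vector) \<Rightarrow> 'a" where
  "delta_integral T a b f = (let F = (SOME F. delta_antiderivative T f F) in F b - F a)"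

definition regressive :: "real set \<Rightarrow> (real \<Rightarrow> complex) \<Rightarrow> bool" where
  "regressive T \<alpha> \<longleftrightarrow>
     (\<forall>t\<in>kappa T. of_real (graininess T t) * \<alpha> t \<noteq> 2 \<and> of_real (graininess T t) * \<alpha> t \<noteq> - 2)"

(* Only used for h \<ge> 0. *)
definition cayley_zeta :: "real \<Rightarrow> complex \<Rightarrow> complex" where
  "cayley_zeta h z =
     (if h = 0 then z
      else (1 / of_real h) * Ln ((1 + (1/2) * z * of_real h) / (1 - (1/2) * z * of_real h)))"

definition cayley_exp :: "real set \<Rightarrow> (real \<Rightarrow> complex) \<Rightarrow> real \<Rightarrow> complex" where
  "cayley_exp T \<alpha> t = exp (delta_integral T 0 t (\<lambda>s. cayley_zeta (graininess T s) (\<alpha> s)))"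

end

(* An imaginary argument makes the Cayley quotient unimodular, so the integrand is imaginary, and
   the real part of any antiderivative has delta derivative zero, hence is constant on T. What needs
   work is that an antiderivative exists at all, since otherwise the delta integral is an arbitrary
   value. The integrand is rd-continuous because the graininess tends to 0 at dense points and
   cayley_zeta h z tends to l as h tends to 0 and z to l. An rd-continuous g extends to the real line
   as the step-like function G x = g (max {s in T. s <= x}), which has one-sided limits everywhere
   and so is integrable on compact intervals; its indefinite integral is an antiderivative of g. *)
theory Submission
  imports Defs
begin

section \<open>Jump operators and graininess\<close>

lemma forward_jump_le: "s \<in> T \<Longrightarrow> t < s \<Longrightarrow> forward_jump T t \<le> s"
  unfolding forward_jump_def by (auto intro!: cInf_lower bdd_belowI[of _ t])

lemma forward_jump_eq_if_maximal:
  assumes "t \<in> T" "\<not> (\<exists>s\<in>T. s > t)" shows "forward_jump T t = t"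
  using assms unfolding forward_jump_def by (auto intro!: cSup_eq_maximum simp: not_less)

lemma forward_jump_ge: "t \<in> T \<Longrightarrow> t \<le> forward_jump T t"
  by (cases "\<exists>s\<in>T. s > t")
    (auto simp: forward_jump_eq_if_maximal, auto simp: forward_jump_def intro!: cInf_greatest)

lemma forward_jump_in:
  assumes "closed T" "t \<in> T" shows "forward_jump T t \<in> T"
proof (cases "\<exists>s\<in>T. s > t")
  case True
  then have "Inf {s \<in> T. s > t} \<in> T"
    by (intro closed_subset_contains_Inf[OF assms(1)]) (auto intro!: bdd_belowI[of _ t])
  with True show ?thesis by (simp add: forward_jump_def)
next
  case False with assms show ?thesis by (simp add: forward_jump_eq_if_maximal)
qed

lemma right_denseI:
  assumes "t \<in> T" "\<And>e. e > 0 \<Longrightarrow> \<exists>s\<in>T. t < s \<and> s < t + e" shows "right_dense T t"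
proof (rule ccontr)
  assume "\<not> ?thesis"
  then have "forward_jump T t > t" using forward_jump_ge[OF assms(1)] by (simp add: right_dense_def)
  with assms(2)[of "forward_jump T t - t"] show False using forward_jump_le[of _ T t] by force
qed

text \<open>The point \<open>s0\<close> excludes a maximum of \<open>T\<close>, which counts as
  right-dense by convention although nothing of \<open>T\<close> lies to its right.\<close>

lemma right_denseD:
  assumes "right_dense T t" "s0 \<in> T" "t < s0" "e > 0" shows "\<exists>s\<in>T. t < s \<and> s < t + e"
proof (rule ccontr)
  assume none: "\<not> ?thesis"
  have "t + e \<le> Inf {s \<in> T. s > t}" using assms none by (intro cInf_greatest) force+
  with assms show False by (auto simp: right_dense_def forward_jump_def split: if_splits)
qed

lemma left_denseI:
  assumes "t \<in> T" "\<And>e. e > 0 \<Longrightarrow> \<exists>s\<in>T. t - e < s \<and> s < t" shows "left_dense T t"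
proof -
  have "Sup {s \<in> T. s < t} = t"
  proof (rule cSup_eq_non_empty)
    show "{s \<in> T. s < t} \<noteq> {}" using assms(2)[of 1] by auto
    show "\<And>x. x \<in> {s \<in> T. s < t} \<Longrightarrow> x \<le> t" by auto
    fix y assume *: "\<And>x. x \<in> {s \<in> T. s < t} \<Longrightarrow> x \<le> y"
    show "t \<le> y"
    proof (rule ccontr)
      assume "\<not> t \<le> y"
      with assms(2)[of "t - y"] * show False by force
    qed
  qed
  moreover have "\<exists>s\<in>T. s < t" using assms(2)[of 1] by auto
  ultimately show ?thesis by (simp add: left_dense_def backward_jump_def)
qed

lemma kappa_if_not_maximal: "t \<in> T \<Longrightarrow> s \<in> T \<Longrightarrow> t < s \<Longrightarrow> t \<in> kappa T"
  unfolding kappa_def by force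

lemma kappa_if_left_dense: "t \<in> T \<Longrightarrow> left_dense T t \<Longrightarrow> t \<in> kappa T"
  unfolding kappa_def left_scattered_def left_dense_def by simp

section \<open>Graininess near dense points\<close>

lemma graininess_nonneg: "t \<in> T \<Longrightarrow> 0 \<le> graininess T t"
  using forward_jump_ge unfolding graininess_def by force

lemma graininess_le: "s \<in> T \<Longrightarrow> t \<in> T \<Longrightarrow> s < t \<Longrightarrow> graininess T s \<le> t - s"
  using forward_jump_le[of t T s] unfolding graininess_def by simp

text \<open>A jump from \<open>s < t\<close> cannot pass the point \<open>t\<close> of
  \<open>T\<close>, which squeezes the graininess between 0 and \<open>t - s\<close>.\<close>

lemma tendsto_graininess_left:
  assumes "t \<in> T" shows "(graininess T \<longlongrightarrow> 0) (at t within (T \<inter> {..<t}))"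
proof (rule tendsto_sandwich[of "\<lambda>_. 0" _ _ "\<lambda>s. t - s"])
  show "\<forall>\<^sub>F s in at t within T \<inter> {..<t}. 0 \<le> graininess T s"
    by (auto simp: eventually_at_filter graininess_nonneg)
  show "\<forall>\<^sub>F s in at t within T \<inter> {..<t}. graininess T s \<le> t - s"
    using assms by (auto simp: eventually_at_filter graininess_le)
  show "((\<lambda>s. t - s) \<longlongrightarrow> 0) (at t within T \<inter> {..<t})"
    by (auto intro!: tendsto_eq_intros)
qed simp

lemma tendsto_graininess_right_dense:
  assumes "t \<in> T" "right_dense T t" shows "(graininess T \<longlongrightarrow> 0) (at t within T)"
proof (rule tendstoI)
  fix e :: real assume e: "e > 0"
  \<comment> \<open>Jumps from points between \<open>t\<close> and a fixed \<open>s1\<close> in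
    \<open>T\<close> cannot pass \<open>s1\<close>, and right-density puts \<open>s1\<close> within
    \<open>e\<close> of \<open>t\<close>; hence \<open>d = s1 - t\<close>. At a maximum of
    \<open>T\<close> the right side is empty and \<open>d = e\<close> serves. The condition
    \<open>d \<le> e\<close> settles the left side, where the graininess is at most
    \<open>t - s\<close>.\<close>
  obtain d where d: "d > 0" "d \<le> e"
    "\<And>s. s \<in> T \<Longrightarrow> t < s \<Longrightarrow> s < t + d \<Longrightarrow> graininess T s < e"
  proof (cases "\<exists>s\<in>T. s > t")
    case True
    then obtain s1 where s1: "s1 \<in> T" "t < s1" "s1 < t + e"
      using right_denseD[OF assms(2) _ _ e] by blast
    have "graininess T s < e" if "s \<in> T" "t < s" "s < t + (s1 - t)" for s
      using graininess_le[of s T s1] that s1 by simp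
    then show ?thesis using s1 that[of "s1 - t"] by auto
  qed (use e in \<open>auto intro: that[of e]\<close>)
  have "dist (graininess T s) 0 < e" if "s \<in> T" "s \<noteq> t" "dist s t < d" for s
    using that d graininess_nonneg[of s T] graininess_le[of s T t] assms
    by (cases "s < t") (auto simp: dist_real_def)
  then show "\<forall>\<^sub>F s in at t within T. dist (graininess T s) 0 < e"
    unfolding eventually_at using d(1) by blast
qed

section \<open>Functions with vanishing delta derivative\<close>

text \<open>The excluded point \<open>forward_jump T t\<close> is either \<open>t\<close> itself or
  stays away from a neighbourhood of \<open>t\<close>. So limits defining delta derivatives restrict
  to ordinary punctured limits within \<open>T\<close>.\<close>

lemma at_within_le_delta_filter:
  assumes "t \<in> T"
  shows "at t within T \<le> inf (nhds t) (principal (T - {forward_jump T t}))"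
proof (cases "forward_jump T t = t")
  case True then show ?thesis by (simp add: at_within_def)
next
  case False
  then have "\<forall>\<^sub>F s in nhds t. s \<noteq> forward_jump T t" by (intro t1_space_nhds) simp
  note ne = this
  show ?thesis
  proof (rule filter_leI)
    fix P assume "eventually P (inf (nhds t) (principal (T - {forward_jump T t})))"
    then have "\<forall>\<^sub>F s in nhds t. s \<in> T - {forward_jump T t} \<longrightarrow> P s"
      by (simp add: eventually_inf_principal)
    with ne show "eventually P (at t within T)"
      unfolding eventually_at_filter by eventually_elim auto
  qed
qed

text \<open>At a right-scattered \<open>t\<close> the quotient may be evaluated at
  \<open>s = t\<close>, so its limit can only be its value there. At a right-dense \<open>t\<close>
  both sides vanish.\<close>

lemma has_delta_derivative_increment:
  fixes F :: "real \<Rightarrow> 'a::real_normed_vector"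
  assumes "t \<in> T" "has_delta_derivative T F D t"
  shows "F (forward_jump T t) - F t = (forward_jump T t - t) *\<^sub>R D"
proof (cases "forward_jump T t = t")
  case False
  let ?q = "\<lambda>s. (F (forward_jump T t) - F s) /\<^sub>R (forward_jump T t - s)"
  have le: "principal {t} \<le> inf (nhds t) (principal (T - {forward_jump T t}))"
    using assms(1) False by (auto simp: le_filter_def eventually_inf_principal eventually_principal
        dest: eventually_nhds_x_imp_x)
  have "(?q \<longlongrightarrow> D) (principal {t})"
    using tendsto_mono[OF le] assms(2) by (simp add: has_delta_derivative_def)
  moreover have "(?q \<longlongrightarrow> ?q t) (principal {t})" by (rule tendsto_principal_singleton)
  ultimately have "D = ?q t" by (intro tendsto_unique[of "principal {t}"]) (auto simp: principal_eq_bot_iff)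
  with False show ?thesis by simp
qed simp

lemma has_delta_derivative_imp_continuous:
  fixes F :: "real \<Rightarrow> 'a::real_normed_vector"
  assumes "t \<in> T" "has_delta_derivative T F D t"
  shows "(F \<longlongrightarrow> F t) (at t within T)"
proof -
  let ?u = "forward_jump T t"
  have "((\<lambda>s. (F ?u - F s) /\<^sub>R (?u - s)) \<longlongrightarrow> D) (at t within T)"
    using tendsto_mono[OF at_within_le_delta_filter] assms by (auto simp: has_delta_derivative_def)
  \<comment> \<open>Solving the difference quotient for \<open>F s\<close> expresses it through a
    convergent quantity; the increment formula identifies the limit as \<open>F t\<close>.\<close>
  then have "((\<lambda>s. F ?u - (?u - s) *\<^sub>R ((F ?u - F s) /\<^sub>R (?u - s))) \<longlongrightarrow> F ?u - (?u - t) *\<^sub>R D)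
      (at t within T)"
    by (intro tendsto_intros)
  moreover have "\<forall>\<^sub>F s in at t within T. s \<noteq> ?u"
    by (rule filter_leD[OF at_within_le_delta_filter[OF assms(1)]])
      (auto simp: eventually_inf_principal)
  then have "\<forall>\<^sub>F s in at t within T. F ?u - (?u - s) *\<^sub>R ((F ?u - F s) /\<^sub>R (?u - s)) = F s"
    by eventually_elim simp
  ultimately have "(F \<longlongrightarrow> F ?u - (?u - t) *\<^sub>R D) (at t within T)"
    by (rule Lim_transform_eventually)
  moreover have "F ?u - (?u - t) *\<^sub>R D = F t"
    using has_delta_derivative_increment[OF assms] by (simp add: algebra_simps)
  ultimately show ?thesis by simp
qed

(* Continuous induction along T: the bound propagates past the supremum c of the points
   up to which it holds. *)
lemma zero_delta_derivative_increment_le: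
  fixes F :: "real \<Rightarrow> 'a::real_normed_vector"
  assumes cl: "closed T" and D: "\<And>t. t \<in> kappa T \<Longrightarrow> has_delta_derivative T F 0 t"
    and ab: "a \<in> T" "b \<in> T" "a \<le> b" and e: "e > 0"
  shows "norm (F b - F a) \<le> e * (b - a)"
proof -
  \<comment> \<open>Asking for the bound on the whole segment from \<open>a\<close> to
    \<open>t\<close>, not just at \<open>t\<close>, makes it available at every point below the
    supremum.\<close>
  define S where
    "S = {t\<in>T. t \<le> b \<and> a \<le> t \<and> (\<forall>s\<in>T. a \<le> s \<and> s \<le> t \<longrightarrow> norm (F s - F a) \<le> e * (s - a))}"
  define c where "c = Sup S"
  have aS: "a \<in> S" using ab by (auto simp: S_def)
  have bdd: "bdd_above S" by (auto simp: S_def intro!: bdd_aboveI[of _ b])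
  have cT: "c \<in> T"
    unfolding c_def by (rule closed_subset_contains_Sup[OF cl]) (use aS bdd in \<open>auto simp: S_def\<close>)
  have ac: "a \<le> c" unfolding c_def using aS bdd by (rule cSup_upper)
  have cb: "c \<le> b" unfolding c_def using aS by (intro cSup_least) (auto simp: S_def)
  have below: "norm (F s - F a) \<le> e * (s - a)" if "s \<in> T" "a \<le> s" "s < c" for s
  proof -
    obtain t where "t \<in> S" "s < t" using less_cSupD[of S s] \<open>s < c\<close> aS unfolding c_def by blast
    then show ?thesis using that by (auto simp: S_def)
  qed
  \<comment> \<open>A supremum that is not attained is approached from below by points of
    \<open>T\<close>. It is then left-dense, hence in \<open>kappa T\<close>, and continuity of
    \<open>F\<close> carries the bound to \<open>c\<close>.\<close>
  have cS: "c \<in> S"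
  proof (rule ccontr)
    assume nc: "c \<notin> S"
    have "a < c" using nc aS ac by (metis order_le_less)
    have approach: "\<exists>s\<in>T. c - d < s \<and> s < c" if "d > 0" for d :: real
    proof -
      obtain s where "s \<in> S" "c - d < s"
        using less_cSupD[of S "c - d"] \<open>d > 0\<close> aS unfolding c_def by fastforce
      moreover have "s \<le> c" unfolding c_def using \<open>s \<in> S\<close> bdd by (rule cSup_upper)
      moreover have "s \<noteq> c" using \<open>s \<in> S\<close> nc by auto
      ultimately show ?thesis by (auto simp: S_def)
    qed
    have "c \<in> kappa T" using left_denseI[OF cT approach] cT by (intro kappa_if_left_dense)
    then have "(F \<longlongrightarrow> F c) (at c within T)"
      using has_delta_derivative_imp_continuous[OF cT D] by simp
    then have lim: "(F \<longlongrightarrow> F c) (at c within (T \<inter> {..<c}))"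
      by (rule tendsto_within_subset) auto
    have nb: "at c within (T \<inter> {..<c}) \<noteq> bot"
    proof -
      have "c islimpt (T \<inter> {..<c})"
        unfolding islimpt_approachable using approach by (force simp: dist_real_def)
      then show ?thesis by (simp add: trivial_limit_within)
    qed
    have ev: "\<forall>\<^sub>F s in at c within (T \<inter> {..<c}). norm (F s - F a) \<le> e * (s - a)"
      unfolding eventually_at using \<open>a < c\<close> below
      by (intro exI[of _ "c - a"]) (auto simp: dist_real_def)
    have "norm (F c - F a) \<le> e * (c - a)"
      by (rule tendsto_le[OF nb _ _ ev]) (intro tendsto_intros lim)+
    then have "c \<in> S" using cT cb ac below by (force simp: S_def)
    with nc show False by simp
  qed
  then have bc: "norm (F c - F a) \<le> e * (c - a)" using cT ac by (auto simp: S_def)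
  have "c = b"
  proof (rule ccontr)
    assume "c \<noteq> b"
    then have lt: "c < b" using cb by simp
    then have Dc: "has_delta_derivative T F 0 c"
      using D kappa_if_not_maximal[OF cT ab(2)] by simp
    \<comment> \<open>To move past \<open>c\<close>: if \<open>c\<close> is right-scattered, its
      successor is the only point to treat and the increment is 0; if it is right-dense, the
      difference quotient is below \<open>e\<close> in norm near \<open>c\<close>.\<close>
    obtain u where u: "u \<in> T" "c < u" "u \<le> b"
      and inc: "\<And>s. s \<in> T \<Longrightarrow> c < s \<Longrightarrow> s \<le> u \<Longrightarrow> norm (F s - F c) \<le> e * (s - c)"
    proof (cases "right_dense T c")
      case False
      let ?u = "forward_jump T c"
      have "c < ?u" using False forward_jump_ge[OF cT] by (simp add: right_dense_def)
      moreover have "norm (F s - F c) \<le> e * (s - c)" if "s \<in> T" "c < s" "s \<le> ?u" for s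
      proof -
        have "s = ?u" using forward_jump_le[of s T c] that by simp
        then show ?thesis using has_delta_derivative_increment[OF cT Dc] e that by simp
      qed
      ultimately show ?thesis
        using that[of ?u] forward_jump_in[OF cl cT] forward_jump_le[OF ab(2) lt] by blast
    next
      case True
      then have "((\<lambda>s. (F c - F s) /\<^sub>R (c - s)) \<longlongrightarrow> 0) (at c within T)"
        using Dc by (simp add: has_delta_derivative_def right_dense_def at_within_def)
      from tendstoD[OF this e] obtain d where d: "d > 0"
        "\<And>s. s \<in> T \<Longrightarrow> s \<noteq> c \<Longrightarrow> dist s c < d \<Longrightarrow> norm ((F c - F s) /\<^sub>R (c - s)) < e"
        unfolding eventually_at by auto
      obtain u where u: "u \<in> T" "c < u" "u < c + min d (b - c)"
        using right_denseD[OF True ab(2) lt, of "min d (b - c)"] d lt by auto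
      have "norm (F s - F c) \<le> e * (s - c)" if "s \<in> T" "c < s" "s \<le> u" for s
      proof -
        have "norm ((F c - F s) /\<^sub>R (c - s)) < e"
          using d(2)[of s] that u by (simp add: dist_real_def)
        then have "norm (F s - F c) / (s - c) < e"
          using that by (simp add: norm_minus_commute divide_inverse mult.commute)
        then show ?thesis using that by (simp add: divide_less_eq)
      qed
      then show ?thesis using that[of u] u by auto
    qed
    have "norm (F s - F a) \<le> e * (s - a)" if s: "s \<in> T" "a \<le> s" "s \<le> u" for s
    proof -
      consider "s < c" | "s = c" | "c < s" by linarith
      then show ?thesis
      proof cases
        case 3
        have "norm (F s - F a) \<le> norm (F s - F c) + norm (F c - F a)"
          using norm_triangle_ineq[of "F s - F c" "F c - F a"] by simp
        also have "\<dots> \<le> e * (s - c) + e * (c - a)" using inc[OF s(1) 3 s(3)] bc by simp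
        finally show ?thesis by (simp add: algebra_simps)
      qed (use below bc s in auto)
    qed
    then have "u \<in> S" using u ac by (auto simp: S_def)
    then have "u \<le> c" unfolding c_def using bdd by (rule cSup_upper)
    with u show False by simp
  qed
  with bc show ?thesis by simp
qed

lemma zero_delta_derivative_imp_constant:
  fixes F :: "real \<Rightarrow> 'a::real_normed_vector"
  assumes cl: "closed T" and D: "\<And>t. t \<in> kappa T \<Longrightarrow> has_delta_derivative T F 0 t"
    and "a \<in> T" "b \<in> T"
  shows "F a = F b"
proof -
  have le: "F x = F y" if xy: "x \<in> T" "y \<in> T" "x \<le> y" for x y
  proof -
    have "norm (F y - F x) \<le> 0 + e" if "e > 0" for e :: real
    proof -
      \<comment> \<open>This slope turns the bound into at most \<open>e\<close>; the summand 1
        keeps the denominator positive when \<open>x = y\<close>.\<close>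
      have "norm (F y - F x) \<le> (e / (y - x + 1)) * (y - x)"
        using xy that by (intro zero_delta_derivative_increment_le[OF cl D]) simp_all
      also have "\<dots> \<le> e" using xy that by (simp add: field_simps)
      finally show ?thesis by simp
    qed
    then have "norm (F y - F x) \<le> 0" by (rule field_le_epsilon)
    then show ?thesis by simp
  qed
  show ?thesis using le[of a b] le[of b a] assms(3,4) by (metis linear)
qed

section \<open>Existence of antiderivatives\<close>

text \<open>Near each point such a function is uniformly close to a step function. A fine tagged
  division glues these local approximations together, and uniform limits of integrable functions are
  integrable.\<close>

lemma integrable_on_if_one_sided_limits:
  fixes G :: "real \<Rightarrow> 'a::banach"
  assumes left: "\<And>x. \<exists>l. (G \<longlongrightarrow> l) (at_left x)" and right: "\<And>x. \<exists>r. (G \<longlongrightarrow> r) (at_right x)"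
  shows "G integrable_on {a..b}"
proof -
  have "G integrable_on cbox a b"
  proof (rule integrable_uniform_limit)
    fix e :: real assume e: "e > 0"
    have "\<exists>d>0. \<exists>g. (\<forall>y. dist y x < d \<longrightarrow> norm (G y - g y) \<le> e) \<and> (\<forall>u v. g integrable_on {u..v})"
      for x
    proof -
      obtain l r where "(G \<longlongrightarrow> l) (at_left x)" "(G \<longlongrightarrow> r) (at_right x)" using left right by blast
      from this[THEN tendstoD, OF e] obtain d1 d2 where
        d: "d1 > 0" "\<And>y. y < x \<Longrightarrow> dist y x < d1 \<Longrightarrow> dist (G y) l < e"
          "d2 > 0" "\<And>y. y > x \<Longrightarrow> dist y x < d2 \<Longrightarrow> dist (G y) r < e"
        unfolding eventually_at by (auto simp: less_imp_neq)
      \<comment> \<open>The one-sided limits do not control the value at \<open>x\<close>, so it is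
        kept. On either side of \<open>x\<close>, \<open>g\<close> differs from a constant at most
        at \<open>x\<close>.\<close>
      define g where "g y = (if y < x then l else if y = x then G x else r)" for y
      have "g integrable_on {u..v}" for u v
      proof -
        have l: "g integrable_on {p..q}" if "q \<le> x" for p q
          by (rule integrable_spike_finite[of "{x}" _ _ "\<lambda>_. l"]) (use that in \<open>auto simp: g_def\<close>)
        have r: "g integrable_on {p..q}" if "x \<le> p" for p q
          by (rule integrable_spike_finite[of "{x}" _ _ "\<lambda>_. r"]) (use that in \<open>auto simp: g_def\<close>)
        consider "v \<le> x" | "x \<le> u" | "u \<le> x" "x \<le> v" by linarith
        then show ?thesis
          by cases (use l r in \<open>auto intro: Henstock_Kurzweil_Integration.integrable_combine[where c = x]\<close>)
      qed
      moreover have "norm (G y - g y) \<le> e" if "dist y x < min d1 d2" for y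
        using that d(2)[of y] d(4)[of y] e by (auto simp: g_def dist_norm)
      ultimately show ?thesis using d by (intro exI[of _ "min d1 d2"]) auto
    qed
    then obtain d where d: "\<And>x. d x > 0"
      "\<And>x. \<exists>g. (\<forall>y. dist y x < d x \<longrightarrow> norm (G y - g y) \<le> e) \<and> (\<forall>u v. g integrable_on {u..v})"
      by metis
    \<comment> \<open>Cousin's lemma: every piece of the division lies in the ball around its tag,
      where one local approximation works.\<close>
    have "gauge (\<lambda>x. ball x (d x))" using d by (simp add: gauge_def)
    then obtain p where p: "p tagged_division_of cbox a b" "(\<lambda>x. ball x (d x)) fine p"
      by (rule fine_division_exists)
    have "\<forall>K\<in>snd ` p. \<exists>g. (\<forall>y\<in>K. norm (G y - g y) \<le> e) \<and> g integrable_on K"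
    proof
      fix K assume "K \<in> snd ` p"
      obtain x where x: "(x, K) \<in> p" using \<open>K \<in> snd ` p\<close> by auto
      then have sub: "K \<subseteq> ball x (d x)" using p(2) by (auto simp: fine_def)
      obtain u v where K: "K = cbox u v" using p(1) x by blast
      obtain g where "\<forall>y. dist y x < d x \<longrightarrow> norm (G y - g y) \<le> e" "\<forall>u v. g integrable_on {u..v}"
        using d(2) by blast
      moreover from this sub have "\<forall>y\<in>K. norm (G y - g y) \<le> e"
        by (metis dist_commute mem_ball subsetD)
      ultimately show "\<exists>g. (\<forall>y\<in>K. norm (G y - g y) \<le> e) \<and> g integrable_on K"
        using K by auto
    qed
    from approximable_on_division[OF less_imp_le[OF e] division_of_tagged_division[OF p(1)] this]
    show "\<exists>g. (\<forall>x\<in>cbox a b. norm (G x - g x) \<le> e) \<and> g integrable_on cbox a b" by metis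
  qed
  then show ?thesis by simp
qed

(* Below the minimum of T this is the junk value Sup {}, which is harmless because it is constant. *)
definition last_before :: "real set \<Rightarrow> real \<Rightarrow> real" where
  "last_before T x = Sup {s \<in> T. s \<le> x}"

lemma last_before_props:
  assumes "closed T" "s \<in> T" "s \<le> x"
  shows "last_before T x \<in> T" "s \<le> last_before T x" "last_before T x \<le> x"
proof -
  have bdd: "bdd_above {s \<in> T. s \<le> x}" by (auto intro!: bdd_aboveI[of _ x])
  show "last_before T x \<in> T"
    unfolding last_before_def using assms bdd by (intro closed_subset_contains_Sup[of T]) auto
  show "s \<le> last_before T x" unfolding last_before_def using assms bdd by (intro cSup_upper) auto
  show "last_before T x \<le> x" unfolding last_before_def using assms by (intro cSup_least) auto
qed

lemma last_before_eq:
  assumes "x \<le> y" "\<And>s. s \<in> T \<Longrightarrow> x < s \<Longrightarrow> s \<le> y \<Longrightarrow> False"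
  shows "last_before T y = last_before T x"
proof -
  have "{s \<in> T. s \<le> y} = {s \<in> T. s \<le> x}" using assms by force
  then show ?thesis by (simp add: last_before_def)
qed

lemma last_before_self:
  assumes "closed T" "t \<in> T" shows "last_before T t = t"
  using last_before_props[OF assms, of t] by simp

section \<open>One-sided limits of the step-like extension\<close>

text \<open>If \<open>T\<close> accumulates at \<open>x\<close> from the right,
  \<open>last_before\<close> tends to \<open>x\<close> through points of \<open>T\<close> and
  continuity of \<open>g\<close> at the right-dense point \<open>x\<close> applies. Otherwise
  \<open>last_before\<close> is constant just to the right of \<open>x\<close>.\<close>

lemma right_limit_last_before:
  assumes cl: "closed T" and rd: "rd_continuous T g"
  shows "\<exists>r. ((\<lambda>x. g (last_before T x)) \<longlongrightarrow> r) (at_right x)"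
proof (cases "\<forall>e>0. \<exists>s\<in>T. x < s \<and> s < x + e")
  case True
  then have "x \<in> closure T" unfolding closure_approachable by (force simp: dist_real_def)
  then have x: "x \<in> T" using cl by simp
  have "right_dense T x" using right_denseI[OF x] True by blast
  then have "(g \<longlongrightarrow> g x) (at x within T)" using rd x by (simp add: rd_continuous_def)
  \<comment> \<open>Since the limit is the value \<open>g x\<close>, the point \<open>x\<close> may
    be included, and \<open>last_before T y\<close> need not be shown to differ from
    \<open>x\<close>.\<close>
  then have g: "(g \<longlongrightarrow> g x) (inf (nhds x) (principal T))"
    by (simp add: tendsto_at_iff_tendsto_nhds_within)
  have "(last_before T \<longlongrightarrow> x) (at_right x)"
    by (rule tendsto_sandwich[of "\<lambda>_. x" _ _ "\<lambda>y. y"])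
      (use last_before_props[OF cl x] in \<open>auto simp: eventually_at_filter\<close>)
  moreover have "\<forall>\<^sub>F y in at_right x. last_before T y \<in> T"
    using last_before_props[OF cl x] by (auto simp: eventually_at_filter)
  ultimately have "filterlim (last_before T) (inf (nhds x) (principal T)) (at_right x)"
    by (simp add: filterlim_inf filterlim_principal)
  from filterlim_compose[OF g this] show ?thesis by blast
next
  case False
  then obtain e where e: "e > 0" "\<And>s. s \<in> T \<Longrightarrow> x < s \<Longrightarrow> s < x + e \<Longrightarrow> False" by blast
  have "\<forall>\<^sub>F y in at_right x. y < x + e"
    using e(1) by (auto simp: eventually_at_right_field intro!: exI[of _ "x + e"])
  moreover have "\<forall>\<^sub>F y in at_right x. y > x" by (auto simp: eventually_at_filter)
  ultimately have "\<forall>\<^sub>F y in at_right x. g (last_before T x) = g (last_before T y)"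
  proof eventually_elim
    case (elim y)
    have "last_before T y = last_before T x"
    proof (rule last_before_eq)
      show False if "s \<in> T" "x < s" "s \<le> y" for s using e(2)[of s] elim that by simp
    qed (use elim in simp)
    then show ?case by simp
  qed
  from Lim_transform_eventually[OF tendsto_const this] show ?thesis by (rule exI)
qed

text \<open>The left-hand limit at a left-dense point may differ from \<open>g x\<close>, so here
  \<open>last_before\<close> must be kept strictly below \<open>x\<close>. If \<open>T\<close>
  leaves a gap just to the left of \<open>x\<close>, the extension is constant on that gap.\<close>

lemma left_limit_last_before:
  assumes cl: "closed T" and rd: "rd_continuous T g"
  shows "\<exists>l. ((\<lambda>x. g (last_before T x)) \<longlongrightarrow> l) (at_left x)"
proof (cases "\<forall>e>0. \<exists>s\<in>T. x - e < s \<and> s < x")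
  case True
  then have "x \<in> closure T" unfolding closure_approachable by (force simp: dist_real_def)
  then have x: "x \<in> T" using cl by simp
  have "left_dense T x" using left_denseI[OF x] True by blast
  then obtain l where g: "(g \<longlongrightarrow> l) (at x within (T \<inter> {..<x}))"
    using rd x by (auto simp: rd_continuous_def)
  have "filterlim (last_before T) (at x within (T \<inter> {..<x})) (at_left x)"
    unfolding filterlim_at
  proof (intro conjI tendstoI)
    have near: "\<forall>\<^sub>F y in at_left x. last_before T y \<in> T \<and> last_before T y < x \<and> x - e < last_before T y"
      if "e > 0" for e :: real
    proof -
      obtain s where s: "s \<in> T" "x - e < s" "s < x" using True \<open>e > 0\<close> by blast
      have "\<forall>\<^sub>F y in at_left x. s < y"
        using s by (auto simp: eventually_at_left_field)
      moreover have "\<forall>\<^sub>F y in at_left x. y < x" by (auto simp: eventually_at_filter)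
      ultimately show ?thesis
      proof eventually_elim
        case (elim y)
        then show ?case using last_before_props[OF cl s(1), of y] s(2) by auto
      qed
    qed
    show "\<forall>\<^sub>F y in at_left x. last_before T y \<in> T \<inter> {..<x} \<and> last_before T y \<noteq> x"
      using near[of 1] by (auto elim!: eventually_mono)
    fix e :: real assume "e > 0"
    from near[OF this] show "\<forall>\<^sub>F y in at_left x. dist (last_before T y) x < e"
      by (auto elim!: eventually_mono simp: dist_real_def)
  qed
  from filterlim_compose[OF g this] show ?thesis by blast
next
  case False
  then obtain e where e: "e > 0" "\<And>s. s \<in> T \<Longrightarrow> x - e < s \<Longrightarrow> s < x \<Longrightarrow> False" by blast
  have "\<forall>\<^sub>F y in at_left x. x - e < y"
    using e(1) by (auto simp: eventually_at_left_field intro!: exI[of _ "x - e"])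
  moreover have "\<forall>\<^sub>F y in at_left x. y < x" by (auto simp: eventually_at_filter)
  ultimately have "\<forall>\<^sub>F y in at_left x. g (last_before T (x - e)) = g (last_before T y)"
  proof eventually_elim
    case (elim y)
    have "last_before T y = last_before T (x - e)"
    proof (rule last_before_eq)
      show False if "s \<in> T" "x - e < s" "s \<le> y" for s using e(2)[of s] elim that by simp
    qed (use elim in simp)
    then show ?case by simp
  qed
  from Lim_transform_eventually[OF tendsto_const this] show ?thesis by (rule exI)
qed

lemma delta_antiderivative_exists:
  fixes g :: "real \<Rightarrow> 'a::banach"
  assumes cl: "closed T" and rd: "rd_continuous T g"
  shows "\<exists>F. delta_antiderivative T g F"
proof -
  define G where "G x = g (last_before T x)" for x
  \<comment> \<open>This is the oriented integral from 0 to \<open>x\<close>: at least one of the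
    two terms vanishes, its interval being empty or a point.\<close>
  define F where "F x = integral {0..x} G - integral {x..0} G" for x
  have int: "G integrable_on {a..b}" for a b
    unfolding G_def
    by (intro integrable_on_if_one_sided_limits left_limit_last_before right_limit_last_before cl rd)
  have diff: "F y - F x = integral {x..y} G" if "x \<le> y" for x y
  proof -
    note comb = Henstock_Kurzweil_Integration.integral_combine[OF _ _ int]
    have deg: "integral {p..q} G = 0" if "q \<le> p" for p q
      using that by (cases "p = q") auto
    consider "0 \<le> x" | "y \<le> 0" | "x \<le> 0" "0 \<le> y" by linarith
    then show ?thesis
    proof cases
      case 1 then show ?thesis using comb[of 0 x y] deg[of 0 x] deg[of 0 y] that
        by (simp add: F_def algebra_simps)
    next
      case 2 then show ?thesis using comb[of x y 0] deg[of x 0] deg[of y 0] that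
        by (simp add: F_def algebra_simps)
    next
      case 3 then show ?thesis using comb[of x 0 y] deg[of x 0] deg[of 0 y] that
        by (simp add: F_def algebra_simps)
    qed
  qed
  have cont: "isCont F t" for t
  proof -
    have "continuous_on {t-1..t+1} (\<lambda>x. F (t - 1) + integral {t-1..x} G)"
      by (intro continuous_intros indefinite_integral_continuous_1 int)
    then have "continuous_on {t-1..t+1} F"
      by (rule continuous_on_eq) (simp add: diff[symmetric])
    then show ?thesis by (rule continuous_on_interior) simp
  qed
  have "has_delta_derivative T F (g t) t" if "t \<in> kappa T" for t
  proof -
    have t: "t \<in> T" using that by (simp add: kappa_def)
    let ?u = "forward_jump T t"
    show ?thesis
    proof (cases "?u = t")
      case False
      then have tu: "t < ?u" using forward_jump_ge[OF t] by simp
      \<comment> \<open>No point of \<open>T\<close> lies strictly between \<open>t\<close> and its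
        successor, so \<open>G\<close> has the value \<open>g t\<close> up to the right endpoint,
        which is a null set.\<close>
      have "integral {t..?u} G = integral {t..?u} (\<lambda>_. g t)"
      proof (rule integral_spike[of "{?u}"])
        fix x assume x: "x \<in> {t..?u} - {?u}"
        have "last_before T x = last_before T t"
          using x forward_jump_le[of _ T t] by (intro last_before_eq) force+
        then show "g t = G x" by (simp add: G_def last_before_self[OF cl t])
      qed simp
      then have inc: "F ?u - F t = (?u - t) *\<^sub>R g t" using diff[of t ?u] tu by simp
      have "(F \<longlongrightarrow> F t) (nhds t)" using cont by (simp add: isCont_def tendsto_at_iff_tendsto_nhds)
      then have "((\<lambda>s. (F ?u - F s) /\<^sub>R (?u - s)) \<longlongrightarrow> (F ?u - F t) /\<^sub>R (?u - t)) (nhds t)"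
        using False by (intro tendsto_intros filterlim_ident) auto
      then have "((\<lambda>s. (F ?u - F s) /\<^sub>R (?u - s)) \<longlongrightarrow> g t) (nhds t)" using tu by (simp add: inc)
      then show ?thesis unfolding has_delta_derivative_def by (rule tendsto_mono[OF inf_le1])
    next
      case True
      then have "(g \<longlongrightarrow> g t) (at t within T)"
        using rd t by (simp add: rd_continuous_def right_dense_def)
      have "((\<lambda>s. (F t - F s) /\<^sub>R (t - s)) \<longlongrightarrow> g t) (at t within T)"
      proof (rule tendstoI)
        fix e :: real assume e: "e > 0"
        \<comment> \<open>The integral estimate below is not strict, so half of \<open>e\<close> is
          used to end with a strict inequality.\<close>
        have "e / 2 > 0" using e by simp
        from tendstoD[OF \<open>(g \<longlongrightarrow> g t) (at t within T)\<close> this] obtain d where d: "d > 0"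
          "\<And>s. s \<in> T \<Longrightarrow> s \<noteq> t \<Longrightarrow> dist s t < d \<Longrightarrow> dist (g s) (g t) < e / 2"
          unfolding eventually_at by auto
        \<comment> \<open>As \<open>p\<close> lies in \<open>T\<close>, \<open>last_before\<close>
          maps the interval from \<open>p\<close> to \<open>q\<close> into points of
          \<open>T\<close> within that interval. These are within \<open>d\<close> of
          \<open>t\<close>, so the estimate for \<open>g\<close> on \<open>T\<close> transfers to
          \<open>G\<close>.\<close>
        have bound: "norm ((F q - F p) - (q - p) *\<^sub>R g t) \<le> (e / 2) * (q - p)"
          if pq: "p \<in> T" "q \<in> T" "p \<le> q" "dist p t < d" "dist q t < d" for p q
        proof -
          have "((\<lambda>x. G x - g t) has_integral (integral {p..q} G - (q - p) *\<^sub>R g t)) {p..q}"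
            using pq has_integral_const_real[of "g t" p q]
            by (intro has_integral_diff integrable_integral int) simp
          moreover have "norm (G x - g t) \<le> e / 2" if x: "x \<in> {p..q}" for x
          proof -
            note lb = last_before_props[OF cl pq(1), of x]
            have "dist (last_before T x) t < d" using lb pq x by (auto simp: dist_real_def)
            then show ?thesis using d(2)[of "last_before T x"] lb x e
              by (cases "last_before T x = t") (auto simp: G_def dist_norm)
          qed
          ultimately have "norm (integral {p..q} G - (q - p) *\<^sub>R g t) \<le> (e / 2) * measure lborel {p..q}"
            using e by (intro has_integral_bound_real) auto
          then show ?thesis using pq by (simp add: diff)
        qed
        have "dist ((F t - F s) /\<^sub>R (t - s)) (g t) < e"
          if s: "s \<in> T" "s \<noteq> t" "dist s t < d" for s
        proof -
          have "norm ((F t - F s) - (t - s) *\<^sub>R g t) \<le> (e / 2) * \<bar>t - s\<bar>"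
          proof (cases "s < t")
            case True then show ?thesis using bound[of s t] s t d by simp
          next
            case False
            moreover have "(F s - F t) - (s - t) *\<^sub>R g t = - ((F t - F s) - (t - s) *\<^sub>R g t)"
              by (simp add: algebra_simps)
            ultimately show ?thesis using bound[of t s] s t d by (simp only: norm_minus_cancel) simp
          qed
          moreover have "(F t - F s) /\<^sub>R (t - s) - g t = ((F t - F s) - (t - s) *\<^sub>R g t) /\<^sub>R (t - s)"
            using s by (simp add: scaleR_diff_right)
          ultimately have "dist ((F t - F s) /\<^sub>R (t - s)) (g t) \<le> e / 2"
            using s by (simp add: dist_norm divide_simps mult.commute)
          then show ?thesis using e by simp
        qed
        then show "\<forall>\<^sub>F s in at t within T. dist ((F t - F s) /\<^sub>R (t - s)) (g t) < e"
          unfolding eventually_at using d(1) by blast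
      qed
      then show ?thesis using True by (simp add: has_delta_derivative_def at_within_def)
    qed
  qed
  then show ?thesis by (auto simp: delta_antiderivative_def)
qed

section \<open>The Cayley transformation\<close>

text \<open>With \<open>k = 1 - z h / 2\<close> and \<open>w = z h / k\<close> the Cayley quotient
  is \<open>1 + w\<close>, so \<open>cayley_zeta h z\<close> equals \<open>z / k\<close> times
  \<open>Ln (1 + w) / w\<close>. Here \<open>k\<close> tends to 1, \<open>w\<close> to 0, and the
  last factor to the derivative of \<open>Ln\<close> at 1.\<close>

lemma tendsto_cayley_zeta:
  fixes z :: "'b \<Rightarrow> complex"
  assumes z: "(z \<longlongrightarrow> l) F" and h: "(h \<longlongrightarrow> 0) F"
  shows "((\<lambda>s. cayley_zeta (h s) (z s)) \<longlongrightarrow> l) F"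
proof -
  \<comment> \<open>Filling the removable singularity with 1 lets the same formula cover
    \<open>h s = 0\<close> and \<open>z s = 0\<close>.\<close>
  define \<phi> :: "complex \<Rightarrow> complex" where "\<phi> u = (if u = 0 then 1 else Ln (1 + u) / u)" for u
  define k where "k s = 1 - (1/2) * z s * of_real (h s)" for s
  have "(Ln has_field_derivative inverse 1) (at 1)" by (rule has_field_derivative_Ln) simp
  then have "((\<lambda>u. Ln (1 + u) / u) \<longlongrightarrow> 1) (at 0)" by (simp add: DERIV_def)
  then have "(\<phi> \<longlongrightarrow> 1) (at 0)"
    by (rule Lim_transform_eventually) (auto simp: \<phi>_def eventually_at_filter)
  then have phi: "isCont \<phi> 0" by (simp add: isCont_def \<phi>_def)
  have \<phi>0: "\<phi> 0 = 1" by (simp add: \<phi>_def)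
  have k: "(k \<longlongrightarrow> 1) F" unfolding k_def by (rule tendsto_eq_intros z h refl | simp)+
  have "((\<lambda>s. z s * of_real (h s) / k s) \<longlongrightarrow> 0) F"
    by (rule tendsto_eq_intros z h k refl | simp)+
  then have "((\<lambda>s. \<phi> (z s * of_real (h s) / k s)) \<longlongrightarrow> 1) F"
    using isCont_tendsto_compose[OF phi, of "\<lambda>s. z s * of_real (h s) / k s" F] unfolding \<phi>0 by blast
  from tendsto_mult[OF tendsto_divide[OF z k] this]
  have "((\<lambda>s. z s / k s * \<phi> (z s * of_real (h s) / k s)) \<longlongrightarrow> l) F" by simp
  moreover have "\<forall>\<^sub>F s in F. k s \<noteq> 0" using tendsto_imp_eventually_ne[OF k, of 0] by simp
  then have "\<forall>\<^sub>F s in F. z s / k s * \<phi> (z s * of_real (h s) / k s) = cayley_zeta (h s) (z s)"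
  proof eventually_elim
    case (elim s)
    have "k s + z s * of_real (h s) = 1 + (1/2) * z s * of_real (h s)" by (simp add: k_def)
    then have "1 + z s * of_real (h s) / k s = (1 + (1/2) * z s * of_real (h s)) / k s"
      using elim by (metis add_divide_distrib divide_self)
    then show ?case
      using elim by (cases "z s = 0") (auto simp: cayley_zeta_def \<phi>_def k_def[symmetric] k_def)
  qed
  ultimately show ?thesis by (rule Lim_transform_eventually)
qed

text \<open>At a right-dense point the graininess is 0 and \<open>cayley_zeta 0\<close> is the
  identity, so the limit agrees with the value. At a left-dense point the integrand inherits the
  left-hand limit of \<open>\<alpha>\<close>.\<close>

lemma rd_continuous_cayley_zeta:
  assumes "rd_continuous T \<alpha>"
  shows "rd_continuous T (\<lambda>s. cayley_zeta (graininess T s) (\<alpha> s))"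
  unfolding rd_continuous_def
proof (intro conjI ballI impI)
  fix t assume t: "t \<in> T" "right_dense T t"
  have "cayley_zeta (graininess T t) (\<alpha> t) = \<alpha> t"
    using t by (simp add: graininess_def right_dense_def cayley_zeta_def)
  then show "((\<lambda>s. cayley_zeta (graininess T s) (\<alpha> s)) \<longlongrightarrow> cayley_zeta (graininess T t) (\<alpha> t))
      (at t within T)"
    using assms t tendsto_cayley_zeta[OF _ tendsto_graininess_right_dense]
    by (simp add: rd_continuous_def)
next
  fix t assume t: "t \<in> T" "left_dense T t"
  then show "\<exists>l. ((\<lambda>s. cayley_zeta (graininess T s) (\<alpha> s)) \<longlongrightarrow> l) (at t within T \<inter> {..<t})"
    using assms tendsto_cayley_zeta[OF _ tendsto_graininess_left] by (meson rd_continuous_def)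
qed

text \<open>For imaginary \<open>u\<close> the numbers \<open>1 + u\<close> and \<open>1 - u\<close>
  are conjugate with real part 1, and the real part of \<open>Ln\<close> is the logarithm of the
  modulus.\<close>

lemma Re_cayley_zeta_eq_0:
  assumes "Re z = 0" shows "Re (cayley_zeta h z) = 0"
proof -
  define u where "u = (1/2) * z * of_real h"
  have u: "Re u = 0" using assms by (simp add: u_def)
  then have "1 + u \<noteq> 0" "1 - u \<noteq> 0" by (auto simp: complex_eq_iff)
  moreover have "cmod (1 + u) = cmod (1 - u)" using u by (simp add: cmod_def)
  ultimately have "Re (Ln ((1 + u) / (1 - u))) = 0" by (simp add: Re_Ln norm_divide)
  then show ?thesis using assms by (simp add: cayley_zeta_def u_def Re_divide_of_real)
qed

theorem theorem3p21:
  fixes T :: "real set" and \<alpha> :: "real \<Rightarrow> complex"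
  assumes "time_scale T" and "0 \<in> T"
    and "regressive T \<alpha>" and "rd_continuous T \<alpha>"
    and "\<forall>t\<in>T. Re (\<alpha> t) = 0"
  shows "\<forall>t\<in>T. norm (cayley_exp T \<alpha> t) = 1"
proof
  fix t assume t: "t \<in> T"
  have cl: "closed T" using assms(1) by (simp add: time_scale_def)
  let ?g = "\<lambda>s. cayley_zeta (graininess T s) (\<alpha> s)"
  \<comment> \<open>This names the very choice made inside \<open>delta_integral\<close>, so that
    \<open>cayley_exp\<close> unfolds to \<open>exp (F t - F 0)\<close>.\<close>
  define F where "F = (SOME F. delta_antiderivative T ?g F)"
  have F: "delta_antiderivative T ?g F"
    unfolding F_def
    using someI_ex[OF delta_antiderivative_exists[OF cl rd_continuous_cayley_zeta[OF assms(4)]]] .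
  \<comment> \<open>Taking real parts is linear and continuous, so it commutes with the limit of the
    difference quotient.\<close>
  have "has_delta_derivative T (\<lambda>s. Re (F s)) 0 x" if x: "x \<in> kappa T" for x
  proof -
    have "Re (?g x) = 0" using assms(5) x by (intro Re_cayley_zeta_eq_0) (simp add: kappa_def)
    then show ?thesis
      using F x tendsto_Re[of "\<lambda>s. (F (forward_jump T x) - F s) /\<^sub>R (forward_jump T x - s)" "?g x"]
      by (fastforce simp: delta_antiderivative_def has_delta_derivative_def)
  qed
  then have "Re (F t) = Re (F 0)"
    by (rule zero_delta_derivative_imp_constant[OF cl _ t assms(2)])
  \<comment> \<open>The modulus of \<open>exp w\<close> is \<open>exp (Re w)\<close>, and
    \<open>w = F t - F 0\<close> has real part 0.\<close>
  then show "norm (cayley_exp T \<alpha> t) = 1"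
    by (simp add: cayley_exp_def delta_integral_def F_def[symmetric] Let_def)
qed

end
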